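(* Let $N$ be the once-punctured torus bundle over $S^1$ with monodromy $\varphi=\begin{pmatrix}-1&-2\\-2&-5\end{pmatrix}$, with $$\pi_1(N)=\left\langle a,b,t\ \middle|\ tat^{-1}=b^{-1}a^{-1}b^{-1},\ tbt^{-1}=ba\,(b^{-1}a^{-1}b^{-1})^3\right\rangle ,$$ and let $X_0$ be an irreducible component of the $\mathrm{SL}(2,\mathbb C)$ character variety $X(N)$ which contains the character of a discrete faithful representation. Then, for $\gamma=a^2t\in\pi_1(N)$, the function $\mathrm{tr}_\gamma$ is constant on $X_0$, with value $2i$ or $-2i$.
   Context: $N$ is regarded as a compact 3-manifold whose boundary is a torus; its interior carries a complete hyperbolic metric of finite volume. The generators $a,b$ generate the free group $\pi_1(F)$ of the once-punctured torus fiber $F$. $X(N)$ denotes the set of characters of representations $\pi_1(N)\to\mathrm{SL}(2,\mathbb C)$, a complex affine algebraic set. For $\gamma\in\pi_1(N)$, $\mathrm{tr}_\gamma$ is the regular function on $X(N)$ whose value at the character of $\rho$ is $\mathrm{tr}(\rho(\gamma))$. *)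

theory Defs
  imports "HOL-Analysis.Analysis" "HOL-Algebra.Coset"
begin

section \<open>Groups given by generators and relations\<close>

text \<open>A letter \<open>(x, True)\<close> stands for the generator \<open>x\<close>, and \<open>(x, False)\<close> for its inverse.\<close>

type_synonym 'g word = "('g \<times> bool) list"

definition gen :: "'g \<Rightarrow> 'g word" where
  "gen x = [(x, True)]"

definition word_inv :: "'g word \<Rightarrow> 'g word" where
  "word_inv w = rev (map (\<lambda>(x, s). (x, \<not> s)) w)"

definition word_pow :: "'g word \<Rightarrow> nat \<Rightarrow> 'g word" where
  "word_pow w n = concat (replicate n w)"

text \<open>A pair \<open>(l, r)\<close> in \<open>R\<close> stands for the defining relation \<open>l = r\<close>.\<close>

inductive word_equiv :: "('g word \<times> 'g word) set \<Rightarrow> 'g word \<Rightarrow> 'g word \<Rightarrow> bool"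
  for R :: "('g word \<times> 'g word) set"
where
  refl: "word_equiv R u u"
| sym: "word_equiv R u v \<Longrightarrow> word_equiv R v u"
| trans: "word_equiv R u v \<Longrightarrow> word_equiv R v w \<Longrightarrow> word_equiv R u w"
| cancel: "word_equiv R (u @ [(x, s), (x, \<not> s)] @ v) (u @ v)"
| rel: "(l, r) \<in> R \<Longrightarrow> word_equiv R (u @ l @ v) (u @ r @ v)"

definition word_class :: "('g word \<times> 'g word) set \<Rightarrow> 'g word \<Rightarrow> 'g word set" where
  "word_class R w = {v. word_equiv R w v}"

definition presented_group :: "('g word \<times> 'g word) set \<Rightarrow> 'g word set monoid" where
  "presented_group R =
     \<lparr>carrier = range (word_class R),
      mult = (\<lambda>P Q. \<Union>u\<in>P. \<Union>v\<in>Q. word_class R (u @ v)),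
      one = word_class R []\<rparr>"

lemma word_class_eq_iff: "word_class R u = word_class R v \<longleftrightarrow> word_equiv R u v"
proof
  assume "word_class R u = word_class R v"
  moreover have "v \<in> word_class R v"
    by (simp add: word_class_def word_equiv.refl)
  ultimately show "word_equiv R u v"
    by (simp add: word_class_def set_eq_iff)
next
  assume uv: "word_equiv R u v"
  show "word_class R u = word_class R v"
    unfolding word_class_def
    using word_equiv.trans[OF uv] word_equiv.trans[OF word_equiv.sym[OF uv]] by blast
qed

lemma word_equiv_context:
  "word_equiv R u v \<Longrightarrow> word_equiv R (p @ u @ q) (p @ v @ q)"
proof (induction rule: word_equiv.induct)
  case (cancel u x s v)
  show ?case using word_equiv.cancel[of R "p @ u" x s "v @ q"] by simp
next
  case (rel l r u v)
  show ?case using word_equiv.rel[OF rel, of "p @ u" "v @ q"] by simp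
next
  case (refl u)
  show ?case by (rule word_equiv.refl)
next
  case (sym u v)
  show ?case by (rule word_equiv.sym) (rule sym.IH)
next
  case (trans u v w)
  show ?case by (rule word_equiv.trans) (rule trans.IH)+
qed

lemma word_equiv_append:
  assumes "word_equiv R u u'" "word_equiv R v v'"
  shows "word_equiv R (u @ v) (u' @ v')"
  using word_equiv.trans[OF word_equiv_context[OF assms(1), of "[]" v, simplified]
      word_equiv_context[OF assms(2), of u' "[]", simplified]] .

lemma mult_word_class:
  "word_class R u \<otimes>\<^bsub>presented_group R\<^esub> word_class R v = word_class R (u @ v)"
proof -
  have "word_class R (u' @ v') = word_class R (u @ v)"
    if "u' \<in> word_class R u" "v' \<in> word_class R v" for u' v'
    using that unfolding word_class_eq_iff
    by (intro word_equiv.sym[OF word_equiv_append]) (simp_all add: word_class_def)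
  moreover have "u \<in> word_class R u" "v \<in> word_class R v"
    by (simp_all add: word_class_def word_equiv.refl)
  ultimately have "(\<Union>u'\<in>word_class R u. \<Union>v'\<in>word_class R v. word_class R (u' @ v')) =
      word_class R (u @ v)"
    by blast
  then show ?thesis
    by (simp add: presented_group_def)
qed

lemma word_inv_equiv: "word_equiv R (word_inv w @ w) []"
proof (induction w)
  case Nil
  show ?case by (simp add: word_inv_def word_equiv.refl)
next
  case (Cons c w)
  obtain x s where c: "c = (x, s)" by (cases c)
  have "word_equiv R (word_inv w @ [(x, \<not> s), (x, \<not> \<not> s)] @ w) (word_inv w @ w)"
    by (rule word_equiv.cancel)
  from word_equiv.trans[OF this Cons] show ?case
    by (simp add: c word_inv_def)
qed

lemma group_presented_group: "group (presented_group R)"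
proof (rule groupI)
  fix P assume "P \<in> carrier (presented_group R)"
  then obtain w where w: "P = word_class R w"
    by (auto simp: presented_group_def)
  have "word_class R (word_inv w) \<otimes>\<^bsub>presented_group R\<^esub> P = \<one>\<^bsub>presented_group R\<^esub>"
    unfolding w mult_word_class using word_inv_equiv[of R w]
    by (simp add: presented_group_def word_class_eq_iff)
  then show "\<exists>Q\<in>carrier (presented_group R). Q \<otimes>\<^bsub>presented_group R\<^esub> P = \<one>\<^bsub>presented_group R\<^esub>"
    by (auto simp: presented_group_def)
next
  fix P assume "P \<in> carrier (presented_group R)"
  then obtain w where w: "P = word_class R w"
    by (auto simp: presented_group_def)
  have "\<one>\<^bsub>presented_group R\<^esub> = word_class R []"
    by (simp add: presented_group_def)
  then show "\<one>\<^bsub>presented_group R\<^esub> \<otimes>\<^bsub>presented_group R\<^esub> P = P"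
    unfolding w by (simp add: mult_word_class)
next
  fix P Q S
  assume "P \<in> carrier (presented_group R)" "Q \<in> carrier (presented_group R)"
    "S \<in> carrier (presented_group R)"
  then obtain u v w where "P = word_class R u" "Q = word_class R v" "S = word_class R w"
    by (auto simp: presented_group_def)
  then show "P \<otimes>\<^bsub>presented_group R\<^esub> Q \<otimes>\<^bsub>presented_group R\<^esub> S =
      P \<otimes>\<^bsub>presented_group R\<^esub> (Q \<otimes>\<^bsub>presented_group R\<^esub> S)"
    by (simp add: mult_word_class)
next
  fix P Q
  assume "P \<in> carrier (presented_group R)" "Q \<in> carrier (presented_group R)"
  then obtain u v where "P = word_class R u" "Q = word_class R v"
    by (auto simp: presented_group_def)
  then show "P \<otimes>\<^bsub>presented_group R\<^esub> Q \<in> carrier (presented_group R)"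
    by (simp add: mult_word_class) (simp add: presented_group_def)
qed (simp add: presented_group_def)


section \<open>Representations into SL(2,C) and their characters\<close>

definition SL2C :: "(complex^2^2) monoid" where
  "SL2C = \<lparr>carrier = {M. det M = 1}, mult = (**), one = mat 1\<rparr>"

text \<open>Discreteness refers to the topology of \<open>complex^2^2\<close>, which induces the usual topology
  on \<open>SL2C\<close>.\<close>

definition discrete_faithful_rep :: "('g, 'h) monoid_scheme \<Rightarrow> ('g \<Rightarrow> complex^2^2) \<Rightarrow> bool" where
  "discrete_faithful_rep G \<rho> \<longleftrightarrow>
     \<rho> \<in> hom G SL2C \<and> inj_on \<rho> (carrier G) \<and> discrete (\<rho> ` carrier G)"

definition rep_character :: "('g, 'h) monoid_scheme \<Rightarrow> ('g \<Rightarrow> complex^2^2) \<Rightarrow> 'g \<Rightarrow> complex" where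
  "rep_character G \<rho> = (\<lambda>g\<in>carrier G. trace (\<rho> g))"

definition character_variety :: "('g, 'h) monoid_scheme \<Rightarrow> ('g \<Rightarrow> complex) set" where
  "character_variety G = rep_character G ` hom G SL2C"

definition tr_fun :: "'g \<Rightarrow> ('g \<Rightarrow> complex) \<Rightarrow> complex" where
  "tr_fun g \<xi> = \<xi> g"

text \<open>For finitely generated \<open>G\<close>, finitely many of the functions \<open>tr_fun g\<close> generate the algebra below
  and embed the character variety in some \<open>C^m\<close> as a Zariski closed set (Culler--Shalen). Hence this
  algebra, restricted to the character variety, is its coordinate ring, and its zero sets are exactly
  the Zariski closed sets; no choice of coordinates is needed.\<close>

inductive_set regular_functions ::
    "('g, 'h) monoid_scheme \<Rightarrow> (('g \<Rightarrow> complex) \<Rightarrow> complex) set"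
  for G :: "('g, 'h) monoid_scheme"
where
  const: "(\<lambda>\<xi>. k) \<in> regular_functions G"
| trace: "g \<in> carrier G \<Longrightarrow> tr_fun g \<in> regular_functions G"
| add: "p \<in> regular_functions G \<Longrightarrow> q \<in> regular_functions G \<Longrightarrow>
    (\<lambda>\<xi>. p \<xi> + q \<xi>) \<in> regular_functions G"
| mult: "p \<in> regular_functions G \<Longrightarrow> q \<in> regular_functions G \<Longrightarrow>
    (\<lambda>\<xi>. p \<xi> * q \<xi>) \<in> regular_functions G"

definition zariski_closed :: "('g, 'h) monoid_scheme \<Rightarrow> ('g \<Rightarrow> complex) set \<Rightarrow> bool" where
  "zariski_closed G Z \<longleftrightarrow>
     (\<exists>S \<subseteq> regular_functions G. Z = {\<xi> \<in> character_variety G. \<forall>p\<in>S. p \<xi> = 0})"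

definition zariski_irreducible :: "('g, 'h) monoid_scheme \<Rightarrow> ('g \<Rightarrow> complex) set \<Rightarrow> bool" where
  "zariski_irreducible G Z \<longleftrightarrow> Z \<subseteq> character_variety G \<and> Z \<noteq> {} \<and>
     (\<forall>C D. zariski_closed G C \<longrightarrow> zariski_closed G D \<longrightarrow> Z \<subseteq> C \<union> D \<longrightarrow> Z \<subseteq> C \<or> Z \<subseteq> D)"

definition irreducible_component :: "('g, 'h) monoid_scheme \<Rightarrow> ('g \<Rightarrow> complex) set \<Rightarrow> bool" where
  "irreducible_component G Z \<longleftrightarrow> zariski_irreducible G Z \<and>
     (\<forall>Y. zariski_irreducible G Y \<longrightarrow> Z \<subseteq> Y \<longrightarrow> Y = Z)"


section \<open>The fundamental group of the once-punctured torus bundle\<close>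

datatype generator = Gen_a | Gen_b | Gen_t

abbreviation word_a :: "generator word" where "word_a \<equiv> gen Gen_a"
abbreviation word_b :: "generator word" where "word_b \<equiv> gen Gen_b"
abbreviation word_t :: "generator word" where "word_t \<equiv> gen Gen_t"

text \<open>The images of \<open>a\<close> and \<open>b\<close> under the automorphism of the free group on \<open>a\<close>, \<open>b\<close> (the
  fundamental group of the fiber) induced by the monodromy.\<close>

definition monodromy_a :: "generator word" where
  "monodromy_a = word_inv word_b @ word_inv word_a @ word_inv word_b"

definition monodromy_b :: "generator word" where
  "monodromy_b = word_b @ word_a @ word_pow (word_inv word_b @ word_inv word_a @ word_inv word_b) 3"

definition bundle_relations :: "(generator word \<times> generator word) set" where
  "bundle_relations =
     {(word_t @ word_a @ word_inv word_t, monodromy_a),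
      (word_t @ word_b @ word_inv word_t, monodromy_b)}"

definition pi1_N :: "generator word set monoid" where
  "pi1_N = presented_group bundle_relations"

definition pi1_N_elem :: "generator word \<Rightarrow> generator word set" where
  "pi1_N_elem w = word_class bundle_relations w"

definition exponent_sum :: "generator \<Rightarrow> generator word \<Rightarrow> int" where
  "exponent_sum x w = (\<Sum>(y, s)\<leftarrow>w. if y = x then (if s then 1 else -1) else 0)"

text \<open>On the homology of the fiber the monodromy acts by the (symmetric) matrix \<open>\<phi>\<close>.\<close>

lemma monodromy_matrix:
  "vector [vector [exponent_sum Gen_a monodromy_a, exponent_sum Gen_a monodromy_b],
           vector [exponent_sum Gen_b monodromy_a, exponent_sum Gen_b monodromy_b]] =
   (vector [vector [-1, -2], vector [-2, -5]] :: int^2^2)"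
  by (simp add: exponent_sum_def monodromy_a_def monodromy_b_def word_pow_def word_inv_def
      gen_def numeral_3_eq_3)

end

(* Put x = tr a, y = tr b, z = tr ab and v = t a^2, which is conjugate to a^2 t. Conjugation by v
   sends a b^-1 a to b and a^-1 to b a b. Comparing traces gives 2x = yz and, if y is nonzero,
   z^2 (y^2 - 2) = 8; it also shows that the traceless part of v is orthogonal, for the trace form,
   to those of a and b. Hence it is proportional to [a, b] as soon as tr [a, b] is not 2, that is,
   as soon as y^2 is not 4, and det v = 1 then forces (tr v)^2 = -4. So
   (tr v - 2i)(tr v + 2i) y (y^2 - 4) vanishes on X(N), and on the irreducible set X_0 one factor
   vanishes. It is not the last one: if y = 0 then b^2 = -1, and if y^2 = 4 then a and b commute, so
   in both cases a commutes with b^2; this fails in pi_1(N), as the infinite dihedral quotient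
   a: n -> -n, b: n -> n + 1, t: n -> n shows, and hence for every faithful representation. *)

theory Submission
  imports Defs
begin

section \<open>A dihedral quotient of the bundle group\<close>

text \<open>The infinite dihedral group acting on the integers. The reflection \<open>a\<close> is
  its own inverse, so both signs act alike.\<close>

fun dihedral_letter :: "generator \<times> bool \<Rightarrow> int \<Rightarrow> int" where
  "dihedral_letter (Gen_a, s) n = - n"
| "dihedral_letter (Gen_b, s) n = (if s then n + 1 else n - 1)"
| "dihedral_letter (Gen_t, s) n = n"

lemma dihedral_letter_inverse: "dihedral_letter (x, s) (dihedral_letter (x, \<not> s) n) = n"
  by (cases x) auto

text \<open>As \<open>t\<close> acts trivially, the monodromy has to fix the actions of
  \<open>a\<close> and \<open>b\<close>: indeed b^-1 a^-1 b^-1 acts as a, so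
  \<open>monodromy_b\<close> acts as b a^4 = b.\<close>

lemma dihedral_action_equiv:
  "word_equiv bundle_relations u v \<Longrightarrow> foldr dihedral_letter u n = foldr dihedral_letter v n"
proof (induction arbitrary: n rule: word_equiv.induct)
  case (cancel u x s v)
  then show ?case by (simp add: dihedral_letter_inverse)
next
  case (rel l r u v)
  then show ?case
    by (auto simp: bundle_relations_def monodromy_a_def monodromy_b_def word_pow_def
        word_inv_def gen_def numeral_3_eq_3)
qed auto

lemma a_not_commute_b_squared:
  "pi1_N_elem (word_a @ word_b @ word_b) \<noteq> pi1_N_elem (word_b @ word_b @ word_a)"
proof
  assume "pi1_N_elem (word_a @ word_b @ word_b) = pi1_N_elem (word_b @ word_b @ word_a)"
  \<comment> \<open>The rightmost letter acts first, so starting from 0 the words give -2 and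
    2.\<close>
  then have "foldr dihedral_letter (word_a @ word_b @ word_b) 0 =
      foldr dihedral_letter (word_b @ word_b @ word_a) 0"
    unfolding pi1_N_elem_def word_class_eq_iff by (rule dihedral_action_equiv)
  then show False
    by (simp add: gen_def)
qed


section \<open>Two-by-two matrices\<close>

lemma matrix2_eq_iff:
  fixes M N :: "'a^2^2"
  shows "M = N \<longleftrightarrow> M$1$1 = N$1$1 \<and> M$1$2 = N$1$2 \<and> M$2$1 = N$2$1 \<and> M$2$2 = N$2$2"
  by (auto simp: vec_eq_iff forall_2)

lemma matrix2_mult_nth:
  fixes M N :: "'a::semiring_1^2^2"
  shows "(M ** N)$i$j = M$i$1 * N$1$j + M$i$2 * N$2$j"
  by (simp add: matrix_matrix_mult_def sum_2)

lemma trace_2: "trace (M :: 'a::comm_semiring_1^2^2) = M$1$1 + M$2$2"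
  by (simp add: trace_def sum_2)

lemmas matrix2_entries = matrix2_eq_iff matrix2_mult_nth trace_2 det_2 mat_def

text \<open>The inverse is the adjugate, so traces involving inverses become polynomials in the
  entries.\<close>

lemma SL2_right_inverse_entries:
  fixes N N' :: "'a::idom^2^2"
  assumes "det N = 1" "N ** N' = mat 1"
  shows "N'$1$1 = N$2$2" "N'$1$2 = - N$1$2" "N'$2$1 = - N$2$1" "N'$2$2 = N$1$1"
  using assms unfolding matrix2_entries by (simp_all, algebra+)

lemma trace_mult_SL2_inverse:
  fixes M N N' :: "'a::idom^2^2"
  assumes "det N = 1" "N ** N' = mat 1"
  shows "trace (M ** N') = trace M * trace N - trace (M ** N)"
  using SL2_right_inverse_entries[OF assms] unfolding matrix2_entries
  by (simp add: algebra_simps)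

lemma trace_mult_SL2_square:
  fixes M N :: "'a::idom^2^2"
  assumes "det N = 1"
  shows "trace (M ** N ** N) = trace N * trace (M ** N) - trace M"
  using assms unfolding matrix2_entries by algebra

text \<open>Cayley-Hamilton for \<open>N ** P\<close>, which has determinant 1, gives N P N = tr(N
  P) N - P^-1.\<close>

lemma trace_mult_SL2_sandwich:
  fixes M N P P' :: "'a::idom^2^2"
  assumes N: "det N = 1" and P: "det P = 1" "P ** P' = mat 1"
  shows "trace (M ** N ** P ** N) = trace (N ** P) * trace (M ** N) - trace (M ** P')"
  using N P(1) SL2_right_inverse_entries[OF P] unfolding matrix2_entries by algebra

text \<open>This is the polarized Cayley-Hamilton identity for ab + ba, multiplied by v.\<close>

lemma trace_mult_anticommutator:
  fixes a b v :: "'a::idom^2^2"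
  shows "trace (v ** a ** b) + trace (v ** b ** a) =
    trace a * trace (v ** b) + trace b * trace (v ** a) +
    (trace (a ** b) - trace a * trace b) * trace v"
  unfolding matrix2_entries by algebra

text \<open>The Gram determinant of the traceless parts of \<open>a\<close>, \<open>b\<close>, \<open>v\<close>, whose square root is the
  triple product \<open>trace (v [a, b])\<close>.\<close>
lemma trace_mult_commutator_square:
  fixes a b v :: "complex^2^2"
  assumes det: "det a = 1" "det b = 1" "det v = 1"
    and orth: "2 * trace (v ** a) = trace a * trace v" "2 * trace (v ** b) = trace b * trace v"
  shows "(trace (v ** a ** b) - trace (v ** b ** a))\<^sup>2 =
    ((trace a)\<^sup>2 + (trace b)\<^sup>2 + (trace (a ** b))\<^sup>2 - trace a * trace b * trace (a ** b) - 4) *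
    ((trace v)\<^sup>2 - 4)"
proof -
  \<comment> \<open>Coordinates of the traceless parts; twice the trace form is p1 q1 + 2 p2 q3 + 2
    p3 q2, and \<open>D\<close> below is the determinant of the three coordinate vectors.\<close>
  define p1 p2 p3 where p: "p1 = a$1$1 - a$2$2" "p2 = a$1$2" "p3 = a$2$1"
  define q1 q2 q3 where q: "q1 = b$1$1 - b$2$2" "q2 = b$1$2" "q3 = b$2$1"
  define r1 r2 r3 where r: "r1 = v$1$1 - v$2$2" "r2 = v$1$2" "r3 = v$2$1"
  define D where
    "D = p1 * (q2 * r3 - q3 * r2) - p2 * (q1 * r3 - q3 * r1) + p3 * (q1 * r2 - q2 * r1)"
  have K: "(trace (v ** a ** b) - trace (v ** b ** a))\<^sup>2 = D\<^sup>2"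
    unfolding D_def p q r matrix2_entries by algebra
  have aa: "p1\<^sup>2 + 4 * p2 * p3 = (trace a)\<^sup>2 - 4"
    using det(1) unfolding p matrix2_entries by algebra
  have bb: "q1\<^sup>2 + 4 * q2 * q3 = (trace b)\<^sup>2 - 4"
    using det(2) unfolding q matrix2_entries by algebra
  have vv: "r1\<^sup>2 + 4 * r2 * r3 = (trace v)\<^sup>2 - 4"
    using det(3) unfolding r matrix2_entries by algebra
  have ab: "p1 * q1 + 2 * p2 * q3 + 2 * p3 * q2 = 2 * trace (a ** b) - trace a * trace b"
    unfolding p q matrix2_entries by algebra
  have va: "p1 * r1 + 2 * p2 * r3 + 2 * p3 * r2 = 0"
    using orth(1) unfolding p r matrix2_entries by algebra
  have vb: "q1 * r1 + 2 * q2 * r3 + 2 * q3 * r2 = 0"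
    using orth(2) unfolding q r matrix2_entries by algebra
  \<comment> \<open>The Gram determinant equals \<open>D\<close> squared times the determinant -4 of
    the form. By orthogonality only its first term survives.\<close>
  have "- 4 * D\<^sup>2 = (r1\<^sup>2 + 4 * r2 * r3) * ((p1\<^sup>2 + 4 * p2 * p3) * (q1\<^sup>2 + 4 * q2 * q3) -
      (p1 * q1 + 2 * p2 * q3 + 2 * p3 * q2)\<^sup>2)
    - (p1\<^sup>2 + 4 * p2 * p3) * (q1 * r1 + 2 * q2 * r3 + 2 * q3 * r2)\<^sup>2
    - (q1\<^sup>2 + 4 * q2 * q3) * (p1 * r1 + 2 * p2 * r3 + 2 * p3 * r2)\<^sup>2
    + 2 * (p1 * q1 + 2 * p2 * q3 + 2 * p3 * q2) * (p1 * r1 + 2 * p2 * r3 + 2 * p3 * r2) *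
      (q1 * r1 + 2 * q2 * r3 + 2 * q3 * r2)"
    unfolding D_def by algebra
  then have "- 4 * D\<^sup>2 = - 4 * (((trace a)\<^sup>2 + (trace b)\<^sup>2 + (trace (a ** b))\<^sup>2 -
      trace a * trace b * trace (a ** b) - 4) * ((trace v)\<^sup>2 - 4))"
    unfolding aa bb vv ab va vb by (simp add: algebra_simps power2_eq_square)
  then show ?thesis
    unfolding K by simp
qed

lemma trace_eq_if_conjugate:
  fixes M N v :: "'a::field^'n^'n"
  assumes "det v \<noteq> 0" "M ** v = v ** N"
  shows "trace M = trace N"
proof -
  obtain v' where v': "v ** v' = mat 1" "v' ** v = mat 1"
    using assms(1) invertible_det_nz unfolding invertible_def by blast
  have "trace N = trace (v' ** (v ** N))"
    by (simp add: matrix_mul_assoc v')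
  also have "\<dots> = trace (M ** v ** v')"
    unfolding assms(2)[symmetric] by (rule trace_mul_sym)
  also have "\<dots> = trace M"
    by (simp add: matrix_mul_assoc[symmetric] v')
  finally show ?thesis ..
qed


section \<open>Trace identities for the bundle\<close>

text \<open>Conjugation by \<open>v = t a\<^sup>2\<close> has the short form \<open>a b\<inverse> a \<mapsto> b\<close>, \<open>a\<inverse> \<mapsto> b a b\<close>.\<close>
lemma bundle_relations_simplified:
  fixes a b t A B t' :: "'a::field^'n^'n"
  assumes inv: "a ** A = mat 1" "b ** B = mat 1" "B ** b = mat 1" "t' ** t = mat 1"
    and rels: "t ** a ** t' = B ** A ** B"
      "t ** b ** t' = b ** a ** (B ** A ** B) ** (B ** A ** B) ** (B ** A ** B)"
    and v: "v = t ** a ** a"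
  shows "b ** v = v ** (a ** B ** a)" "b ** a ** b ** v = v ** A"
proof -
  have canc: "a ** (A ** M) = M" "b ** (B ** M) = M" "B ** (b ** M) = M" "t' ** (t ** M) = M"
    for M
    by (simp_all add: matrix_mul_assoc inv)
  note assoc = matrix_mul_assoc[symmetric]
  have ta: "t ** a = B ** (A ** (B ** t))"
    using arg_cong[OF rels(1), of "\<lambda>M. M ** t"] by (simp add: assoc inv)
  have t: "b ** (a ** (b ** (t ** a))) = t"
    by (simp add: ta canc)
  \<comment> \<open>The first relation, read backwards, makes the cube telescope to t a^3
    t^-1.\<close>
  have "t ** b = b ** a ** (t ** a ** t') ** (t ** a ** t') ** (t ** a ** t') ** t"
    using arg_cong[OF rels(2), of "\<lambda>M. M ** t"] unfolding rels(1)[symmetric]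
    by (simp add: assoc inv)
  also have "\<dots> = b ** (a ** (t ** (a ** (a ** a))))"
    by (simp add: assoc inv canc)
  finally have tb: "t ** b = b ** (a ** (t ** (a ** (a ** a))))" .
  have A: "A ** a = mat 1"
    using inv(1) matrix_left_right_inverse by blast
  then have "t ** (a ** (a ** a)) = A ** (B ** (t ** b))"
    unfolding tb by (simp add: matrix_mul_assoc inv)
  \<comment> \<open>Substituting t = b a b t a once more cancels the prefix a^-1 b^-1.\<close>
  also have "t ** b = b ** (a ** (b ** (t ** (a ** b))))"
    using arg_cong[OF t, of "\<lambda>M. M ** b"] by (simp add: assoc)
  also have "A ** (B ** (b ** (a ** (b ** (t ** (a ** b)))))) = b ** (t ** (a ** b))"
    using A by (simp add: matrix_mul_assoc inv)
  finally have "t ** (a ** (a ** a)) = b ** (t ** (a ** b))" .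
  then have "t ** (a ** (a ** a)) ** (B ** a) = b ** (t ** (a ** b)) ** (B ** a)"
    by simp
  then show "b ** v = v ** (a ** B ** a)"
    unfolding v by (simp add: assoc canc)
  show "b ** a ** b ** v = v ** A"
    using arg_cong[OF t, of "\<lambda>M. M ** a"] unfolding v by (simp add: assoc inv)
qed

lemma fiber_trace_equations:
  fixes a b v A B :: "complex^2^2"
  assumes det: "det a = 1" "det b = 1" "det v = 1"
    and inv: "a ** A = mat 1" "b ** B = mat 1" "B ** b = mat 1"
    and R1: "b ** v = v ** (a ** B ** a)"
    and R2: "b ** a ** b ** v = v ** A"
  shows "2 * trace b = trace a * (trace a * trace b - trace (a ** b))"
    and "2 * trace a = trace (a ** b) * trace b"
proof -
  have detB: "det B = 1"
    using inv(2) det(2) by (metis det_I det_mul mult_1)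
  have aB: "trace (a ** B) = trace a * trace b - trace (a ** b)"
    by (rule trace_mult_SL2_inverse[OF det(2) inv(2)])
  \<comment> \<open>The factor \<open>mat 1\<close> plays the part of \<open>M\<close> in the
    sandwich formula.\<close>
  have "trace b = trace (mat 1 ** a ** B ** a)"
    using trace_eq_if_conjugate[OF _ R1] det(3) by simp
  then show "2 * trace b = trace a * (trace a * trace b - trace (a ** b))"
    unfolding trace_mult_SL2_sandwich[OF det(1) detB inv(3)] aB
    by (simp add: algebra_simps)
  have "trace (mat 1 ** b ** a ** b) = trace A"
    using trace_eq_if_conjugate[OF _ R2] det(3) by simp
  moreover have "trace A = trace a"
    using SL2_right_inverse_entries[OF det(1) inv(1)] by (simp add: trace_2)
  ultimately show "2 * trace a = trace (a ** b) * trace b"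
    unfolding trace_mult_SL2_sandwich[OF det(2) det(1) inv(1)] trace_mul_sym[of b a]
    by simp
qed

text \<open>Eliminating x by 2x = zy leaves a multiple of y, which can be cancelled.\<close>

lemma fiber_trace_curve:
  fixes x y z :: complex
  assumes "2 * y = x * (x * y - z)" "2 * x = z * y" "y \<noteq> 0"
  shows "z\<^sup>2 * (y\<^sup>2 - 2) - 8 = 0"
proof -
  have "y * (z\<^sup>2 * (y\<^sup>2 - 2) - 8) = 0"
    using assms(1,2) by algebra
  with assms(3) show ?thesis
    by simp
qed

text \<open>Traces of the conjugation relations, also after multiplication by b, are linear in tr v,
  tr va, tr vb and tr vab. They determine the triple product \<open>K\<close> as a multiple of tr v;
  the Gram formula gives its square a second time.\<close>

lemma bundle_trace_constant:
  fixes a b v A B :: "complex^2^2"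
  assumes det: "det a = 1" "det b = 1" "det v = 1"
    and inv: "a ** A = mat 1" "b ** B = mat 1" "B ** b = mat 1"
    and R1: "b ** v = v ** (a ** B ** a)"
    and R2: "b ** a ** b ** v = v ** A"
    and b: "trace b \<noteq> 0" "(trace b)\<^sup>2 \<noteq> 4"
  shows "(trace v)\<^sup>2 = - 4"
proof -
  define x y z V where xyz: "x = trace a" "y = trace b" "z = trace (a ** b)" "V = trace v"
  define \<nu> \<beta> where nb: "\<nu> = trace (v ** a)" "\<beta> = trace (v ** b)"
  have detB: "det B = 1"
    using inv(2) det(2) by (metis det_I det_mul mult_1)
  have aB: "trace (a ** B) = x * y - z"
    by (simp add: trace_mult_SL2_inverse[OF det(2) inv(2)] xyz)
  have ba: "trace (b ** a) = z"
    unfolding xyz by (rule trace_mul_sym)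
  have eq1: "2 * \<beta> = (x * y - z) * \<nu>"
  proof -
    have "\<beta> = trace (v ** a ** B ** a)"
      using R1 by (metis matrix_mul_assoc nb(2) trace_mul_sym)
    then show ?thesis
      by (simp add: trace_mult_SL2_sandwich[OF det(1) detB inv(3)] aB nb)
  qed
  have vA: "trace (v ** A) = x * V - \<nu>"
    by (simp add: trace_mult_SL2_inverse[OF det(1) inv(1)] xyz nb)
  have eq2: "2 * (x * V - \<nu>) = z * \<beta>"
  proof -
    have "trace (v ** b ** a ** b) = trace (v ** A)"
      using arg_cong[OF R2, of trace]
      by (metis matrix_mul_assoc trace_mul_sym)
    then show ?thesis
      by (simp add: trace_mult_SL2_sandwich[OF det(2) det(1) inv(1)] ba vA nb algebra_simps)
  qed
  \<comment> \<open>Multiplying \<open>R1\<close> by b before taking traces brings in tr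
    vab.\<close>
  have eq3: "2 * (y * \<beta> - V) = (x * y - z) * trace (v ** a ** b)"
  proof -
    have bb: "trace (v ** b ** b) = y * \<beta> - V"
      by (simp add: trace_mult_SL2_square[OF det(2)] xyz nb)
    have "trace (v ** b ** b) = trace (b ** v ** a ** B ** a)"
      using arg_cong[OF R1, of "\<lambda>M. trace (b ** M)"]
      by (metis matrix_mul_assoc trace_mul_sym)
    also have "\<dots> = (x * y - z) * trace (v ** a ** b) - trace (v ** b ** b)"
      unfolding trace_mult_SL2_sandwich[OF det(1) detB inv(3)] aB
      by (metis matrix_mul_assoc trace_mul_sym)
    finally show ?thesis
      unfolding bb by algebra
  qed
  note c = fiber_trace_equations[OF det inv R1 R2, folded xyz]
  have y: "y \<noteq> 0" "y\<^sup>2 \<noteq> 4"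
    using b by (simp_all add: xyz)
  note curve = fiber_trace_curve[OF c y(1)]
  have z: "z \<noteq> 0"
    using curve by auto
  \<comment> \<open>The curve equation in the form that turns the factor x y - z into 4/z.\<close>
  have wz: "(x * y - z) * z = 4"
    using curve c(2) by algebra
  have "8 * \<beta> = 4 * V * y"
  proof -
    have "8 * \<beta> = 2 * (x * y - z) * x * V"
      using eq1 eq2 wz by algebra
    with c(1) show ?thesis by algebra
  qed
  \<comment> \<open>This and the next equation state the orthogonality of the traceless part of v to
    those of a and b.\<close>
  then have \<beta>: "2 * \<beta> = y * V"
    by simp
  have \<nu>: "2 * \<nu> = x * V"
    using eq2 \<beta> c(2) by algebra
  define K where "K = trace (v ** a ** b) - trace (v ** b ** a)"
  have "4 * trace (v ** a ** b) = z * (y\<^sup>2 - 2) * V"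
    using eq3 \<beta> wz by algebra
  moreover have "trace (v ** a ** b) + trace (v ** b ** a) = z * V"
    using trace_mult_anticommutator[of v a b] \<beta> \<nu> unfolding xyz[symmetric] nb[symmetric] by algebra
  ultimately have K: "2 * K = V * z * (y\<^sup>2 - 4)"
    unfolding K_def by algebra
  have "K\<^sup>2 = (x\<^sup>2 + y\<^sup>2 + z\<^sup>2 - x * y * z - 4) * (V\<^sup>2 - 4)"
    unfolding K_def xyz
    by (intro trace_mult_commutator_square det) (use \<beta> \<nu> in \<open>simp_all add: xyz nb\<close>)
  \<comment> \<open>The bracket is tr [a, b] - 2.\<close>
  moreover have "8 * (x\<^sup>2 + y\<^sup>2 + z\<^sup>2 - x * y * z - 4) = z\<^sup>2 * (y\<^sup>2 - 4)\<^sup>2"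
    using c(2) curve by algebra
  \<comment> \<open>The two values of \<open>K\<close> squared are z^2 (y^2 - 4)^2 times V^2 / 4 and
    times (V^2 - 4) / 8.\<close>
  ultimately have "z\<^sup>2 * (y\<^sup>2 - 4)\<^sup>2 * (V\<^sup>2 + 4) = 0"
    using K by algebra
  then have "V\<^sup>2 + 4 = 0"
    using y z by simp
  then show ?thesis
    by (simp add: xyz eq_neg_iff_add_eq_0)
qed

text \<open>The traceless parts span a totally isotropic subspace of a nondegenerate ternary form.
  Its dimension is at most 1, so they are proportional.\<close>

lemma SL2_parabolic_commute:
  fixes a b :: "complex^2^2"
  assumes det: "det a = 1" "det b = 1"
    and par: "(trace a)\<^sup>2 = 4" "(trace b)\<^sup>2 = 4" "2 * trace (a ** b) = trace a * trace b"
  shows "a ** b = b ** a"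
proof -
  define p1 p2 p3 where p: "p1 = a$1$1 - a$2$2" "p2 = a$1$2" "p3 = a$2$1"
  define q1 q2 q3 where q: "q1 = b$1$1 - b$2$2" "q2 = b$1$2" "q3 = b$2$1"
  have aa: "p1\<^sup>2 + 4 * p2 * p3 = 0"
    using det(1) par(1) unfolding p matrix2_entries by algebra
  have bb: "q1\<^sup>2 + 4 * q2 * q3 = 0"
    using det(2) par(2) unfolding q matrix2_entries by algebra
  have ab: "p1 * q1 + 2 * p2 * q3 + 2 * p3 * q2 = 0"
    using par(3) unfolding p q matrix2_entries by algebra
  \<comment> \<open>The squares of the minors, unlike the minors, lie in the ideal generated by the
    three relations.\<close>
  have "(p1 * q2 - p2 * q1)\<^sup>2 = 0" "(p1 * q3 - p3 * q1)\<^sup>2 = 0" "(p2 * q3 - p3 * q2)\<^sup>2 = 0"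
    using aa bb ab by algebra+
  then have "p1 * q2 = p2 * q1" "p1 * q3 = p3 * q1" "p2 * q3 = p3 * q2"
    by simp_all
  then show ?thesis
    unfolding p q matrix2_entries by (auto simp: algebra_simps)
qed

lemma bundle_trace_degenerate:
  fixes a b v A B :: "complex^2^2"
  assumes det: "det a = 1" "det b = 1" "det v = 1"
    and inv: "a ** A = mat 1" "b ** B = mat 1" "B ** b = mat 1"
    and R1: "b ** v = v ** (a ** B ** a)"
    and R2: "b ** a ** b ** v = v ** A"
    and b: "trace b = 0 \<or> (trace b)\<^sup>2 = 4"
  shows "a ** b ** b = b ** b ** a"
proof (cases "trace b = 0")
  case True
  \<comment> \<open>Cayley-Hamilton with trace 0 makes b^2 the central matrix -1.\<close>
  then have "b ** b = mat (- 1)"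
    using det(2) unfolding matrix2_entries by (simp, algebra)
  then show ?thesis
    by (simp add: matrix_mul_assoc[symmetric]) (simp add: matrix2_entries)
next
  case False
  define x y z where xyz: "x = trace a" "y = trace b" "z = trace (a ** b)"
  note c = fiber_trace_equations[OF det inv R1 R2, folded xyz]
  have y: "y\<^sup>2 - 4 = 0"
    using b False xyz by auto
  have z: "z\<^sup>2 - 4 = 0"
    using fiber_trace_curve[OF c] False y xyz by simp
  have x: "x\<^sup>2 = 4"
    using c(2) y z by algebra
  have "2 * z = x * y"
    using c(2) y by algebra
  then have "a ** b = b ** a"
    using det x y xyz by (intro SL2_parabolic_commute) simp_all
  then show ?thesis
    by (metis matrix_mul_assoc)
qed


section \<open>Representations of the bundle group\<close>

lemma pi1_N_elem_carrier: "pi1_N_elem w \<in> carrier pi1_N"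
  by (simp add: pi1_N_elem_def pi1_N_def presented_group_def)

context
  fixes \<rho> :: "generator word set \<Rightarrow> complex^2^2"
  assumes hom: "\<rho> \<in> hom pi1_N SL2C"
begin

lemma rep_det: "det (\<rho> (pi1_N_elem w)) = 1"
  using hom pi1_N_elem_carrier[of w] by (auto simp: hom_def SL2C_def)

lemma rep_append: "\<rho> (pi1_N_elem (u @ v)) = \<rho> (pi1_N_elem u) ** \<rho> (pi1_N_elem v)"
proof -
  have "pi1_N_elem (u @ v) = pi1_N_elem u \<otimes>\<^bsub>pi1_N\<^esub> pi1_N_elem v"
    by (simp add: pi1_N_elem_def pi1_N_def mult_word_class)
  then show ?thesis
    using hom_mult[OF hom pi1_N_elem_carrier pi1_N_elem_carrier] by (simp add: SL2C_def)
qed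

text \<open>Membership in \<open>hom\<close> gives multiplicativity, so the image of the unit is
  idempotent; determinant 1 makes it invertible.\<close>

lemma rep_Nil: "\<rho> (pi1_N_elem []) = mat 1"
proof -
  let ?E = "\<rho> (pi1_N_elem [])"
  obtain E' where "E' ** ?E = mat 1"
    using rep_det[of "[]"] invertible_det_nz[of ?E] unfolding invertible_def by auto
  moreover have "?E ** ?E = ?E"
    using rep_append[of "[]" "[]"] by simp
  ultimately show ?thesis
    by (metis matrix_mul_assoc matrix_mul_lid)
qed

lemma rep_word_inv: "\<rho> (pi1_N_elem (word_inv w)) ** \<rho> (pi1_N_elem w) = mat 1"
proof -
  have "pi1_N_elem (word_inv w @ w) = pi1_N_elem []"
    unfolding pi1_N_elem_def word_class_eq_iff by (rule word_inv_equiv)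
  then show ?thesis
    using rep_append[of "word_inv w" w] rep_Nil by simp
qed

lemma rep_relation:
  assumes "(l, r) \<in> bundle_relations"
  shows "\<rho> (pi1_N_elem l) = \<rho> (pi1_N_elem r)"
proof -
  have "pi1_N_elem l = pi1_N_elem r"
    unfolding pi1_N_elem_def word_class_eq_iff
    using word_equiv.rel[OF assms, of "[]" "[]"] by simp
  then show ?thesis
    by simp
qed

abbreviation (input) "rep_tr w \<equiv> trace (\<rho> (pi1_N_elem w))"

lemma bundle_rep_cases:
  shows "rep_tr word_b \<noteq> 0 \<Longrightarrow> (rep_tr word_b)\<^sup>2 \<noteq> 4 \<Longrightarrow>
      (rep_tr (word_a @ word_a @ word_t))\<^sup>2 = - 4" (is "_ \<Longrightarrow> _ \<Longrightarrow> ?const")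
    and "rep_tr word_b = 0 \<or> (rep_tr word_b)\<^sup>2 = 4 \<Longrightarrow>
      \<rho> (pi1_N_elem (word_a @ word_b @ word_b)) = \<rho> (pi1_N_elem (word_b @ word_b @ word_a))"
proof -
  define a b t where "a = \<rho> (pi1_N_elem word_a)" "b = \<rho> (pi1_N_elem word_b)"
    "t = \<rho> (pi1_N_elem word_t)"
  define A B t' where "A = \<rho> (pi1_N_elem (word_inv word_a))"
    "B = \<rho> (pi1_N_elem (word_inv word_b))" "t' = \<rho> (pi1_N_elem (word_inv word_t))"
  note defs = \<open>a = _\<close> \<open>b = _\<close> \<open>t = _\<close> \<open>A = _\<close> \<open>B = _\<close> \<open>t' = _\<close>
  define v where v: "v = t ** a ** a"
  have inv': "A ** a = mat 1" "B ** b = mat 1" "t' ** t = mat 1"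
    unfolding defs by (rule rep_word_inv)+
  then have inv: "a ** A = mat 1" "b ** B = mat 1" "B ** b = mat 1" "t' ** t = mat 1"
    using matrix_left_right_inverse by blast+
  have det: "det a = 1" "det b = 1" "det v = 1"
    unfolding v det_mul by (simp_all add: defs rep_det)
  have "t ** a ** t' = B ** A ** B"
    using rep_relation[of "word_t @ word_a @ word_inv word_t" monodromy_a]
    by (simp add: bundle_relations_def monodromy_a_def rep_append defs matrix_mul_assoc)
  moreover have "t ** b ** t' = b ** a ** (B ** A ** B) ** (B ** A ** B) ** (B ** A ** B)"
    using rep_relation[of "word_t @ word_b @ word_inv word_t" monodromy_b]
    by (simp add: bundle_relations_def monodromy_b_def word_pow_def numeral_3_eq_3 rep_append
        rep_Nil defs matrix_mul_assoc)
  ultimately have R: "b ** v = v ** (a ** B ** a)" "b ** a ** b ** v = v ** A"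
    using bundle_relations_simplified[OF inv _ _ v] by blast+
  \<comment> \<open>The words a^2 t and t a^2 differ by a cyclic permutation.\<close>
  have "rep_tr (word_a @ word_a @ word_t) = trace v"
    unfolding v rep_append defs by (metis matrix_mul_assoc trace_mul_sym)
  then show "rep_tr word_b \<noteq> 0 \<Longrightarrow> (rep_tr word_b)\<^sup>2 \<noteq> 4 \<Longrightarrow> ?const"
    using bundle_trace_constant[OF det inv(1-3) R] by (simp add: defs)
  show "rep_tr word_b = 0 \<or> (rep_tr word_b)\<^sup>2 = 4 \<Longrightarrow>
      \<rho> (pi1_N_elem (word_a @ word_b @ word_b)) = \<rho> (pi1_N_elem (word_b @ word_b @ word_a))"
    using bundle_trace_degenerate[OF det inv(1-3) R]
    by (simp add: rep_append defs matrix_mul_assoc)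
qed

end


section \<open>Irreducible sets of characters\<close>

lemma zariski_closed_zeros:
  assumes "p \<in> regular_functions G"
  shows "zariski_closed G {\<xi> \<in> character_variety G. p \<xi> = 0}"
  unfolding zariski_closed_def using assms by (intro exI[of _ "{p}"]) auto

text \<open>The zero sets of \<open>p\<close> and \<open>q\<close> are closed and cover
  \<open>Z\<close>.\<close>

lemma zariski_irreducible_mult_zero:
  assumes Z: "zariski_irreducible G Z"
    and p: "p \<in> regular_functions G" and q: "q \<in> regular_functions G"
    and zero: "\<And>\<xi>. \<xi> \<in> Z \<Longrightarrow> p \<xi> * q \<xi> = 0"
  shows "(\<forall>\<xi>\<in>Z. p \<xi> = 0) \<or> (\<forall>\<xi>\<in>Z. q \<xi> = 0)"
proof -
  have "Z \<subseteq> {\<xi> \<in> character_variety G. p \<xi> = 0} \<union> {\<xi> \<in> character_variety G. q \<xi> = 0}"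
    using Z zero unfolding zariski_irreducible_def by fastforce
  then show ?thesis
    using Z zariski_closed_zeros[OF p] zariski_closed_zeros[OF q]
    unfolding zariski_irreducible_def by blast
qed

theorem mainTheorem4:
  fixes X\<^sub>0 :: "(generator word set \<Rightarrow> complex) set"
    and \<rho> :: "generator word set \<Rightarrow> complex^2^2"
  assumes "irreducible_component pi1_N X\<^sub>0"
    and "discrete_faithful_rep pi1_N \<rho>"
    and "rep_character pi1_N \<rho> \<in> X\<^sub>0"
  shows "(\<forall>\<xi>\<in>X\<^sub>0. tr_fun (pi1_N_elem (word_a @ word_a @ word_t)) \<xi> = 2 * \<i>) \<or>
         (\<forall>\<xi>\<in>X\<^sub>0. tr_fun (pi1_N_elem (word_a @ word_a @ word_t)) \<xi> = - (2 * \<i>))"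
proof -
  define V where "V = tr_fun (pi1_N_elem (word_a @ word_a @ word_t))"
  define y where "y = tr_fun (pi1_N_elem word_b)"
  \<comment> \<open>\<open>f\<close> vanishes exactly at the degenerate characters; it is written
    with sums and products to match the rules of \<open>regular_functions\<close>.\<close>
  define f where "f = (\<lambda>\<xi>. y \<xi> * (y \<xi> * y \<xi> + - 4))"
  have X0: "zariski_irreducible pi1_N X\<^sub>0"
    using assms(1) unfolding irreducible_component_def by blast
  then have sub: "X\<^sub>0 \<subseteq> character_variety pi1_N"
    by (simp add: zariski_irreducible_def)
  have V: "(\<lambda>\<xi>. V \<xi> + k) \<in> regular_functions pi1_N" for k
    unfolding V_def
    by (intro regular_functions.intros pi1_N_elem_carrier)
  have f: "f \<in> regular_functions pi1_N"
    unfolding f_def y_def by (intro regular_functions.intros pi1_N_elem_carrier)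
  have tr: "tr_fun (pi1_N_elem w) (rep_character pi1_N \<sigma>) = trace (\<sigma> (pi1_N_elem w))" for w \<sigma>
    by (simp add: tr_fun_def rep_character_def pi1_N_elem_carrier)
  have zero: "(V \<xi> + - (2 * \<i>)) * ((V \<xi> + 2 * \<i>) * f \<xi>) = 0" if \<xi>: "\<xi> \<in> X\<^sub>0" for \<xi>
  proof -
    obtain \<sigma> where \<sigma>: "\<sigma> \<in> hom pi1_N SL2C" "\<xi> = rep_character pi1_N \<sigma>"
      using subsetD[OF sub \<xi>] by (auto simp: character_variety_def)
    have "(V \<xi>)\<^sup>2 = - 4" if "f \<xi> \<noteq> 0"
      using bundle_rep_cases(1)[OF \<sigma>(1)] that
      unfolding f_def y_def V_def \<sigma>(2) tr by (auto simp: power2_eq_square)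
    moreover have "(V \<xi> + - (2 * \<i>)) * (V \<xi> + 2 * \<i>) = (V \<xi>)\<^sup>2 + 4"
      by (simp add: algebra_simps power2_eq_square)
    ultimately show ?thesis
      by (cases "f \<xi> = 0") (simp_all add: mult.assoc[symmetric])
  qed
  have nonzero: "f (rep_character pi1_N \<rho>) \<noteq> 0"
  proof
    assume "f (rep_character pi1_N \<rho>) = 0"
    then have "\<rho> (pi1_N_elem (word_a @ word_b @ word_b)) =
        \<rho> (pi1_N_elem (word_b @ word_b @ word_a))"
      using assms(2) unfolding f_def y_def tr discrete_faithful_rep_def
      by (intro bundle_rep_cases(2)) (auto simp: power2_eq_square)
    then show False
      using assms(2) a_not_commute_b_squared pi1_N_elem_carrier
      unfolding discrete_faithful_rep_def by (meson inj_onD)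
  qed
  have "(\<lambda>\<xi>. (V \<xi> + 2 * \<i>) * f \<xi>) \<in> regular_functions pi1_N"
    by (intro regular_functions.mult V f)
  from zariski_irreducible_mult_zero[OF X0 V this zero]
  have "(\<forall>\<xi>\<in>X\<^sub>0. V \<xi> + - (2 * \<i>) = 0) \<or> (\<forall>\<xi>\<in>X\<^sub>0. (V \<xi> + 2 * \<i>) * f \<xi> = 0)" .
  \<comment> \<open>A second splitting separates off \<open>f\<close>, which is nonzero at the
    faithful character.\<close>
  moreover have "(\<forall>\<xi>\<in>X\<^sub>0. V \<xi> + 2 * \<i> = 0)" if "\<forall>\<xi>\<in>X\<^sub>0. (V \<xi> + 2 * \<i>) * f \<xi> = 0"
    using zariski_irreducible_mult_zero[OF X0 V f] that nonzero assms(3) by blast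
  ultimately show ?thesis
    unfolding V_def by (auto simp: eq_neg_iff_add_eq_0)
qed

end
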